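(* Let $u_0,g\in L^2(D)$, let $f_1,f_2\in L^2(D)$, and let $R\in L^\infty([0,T])$ satisfy $0<c_R\le R(t)$ for almost every $t\in[0,T]$, where $c_R$ is a positive constant. For $i=1,2$ let $u_i$ be the mild solution of $$du_i=Au_i\,dt+Rf_i\,dt+g\,dw,\quad t\in(0,T],\qquad u_i(0)=u_0 .$$ If $$\mathbb{E}[u_1(x,T)]=\mathbb{E}[u_2(x,T)]\qquad\text{for all }x\in D,$$ then $f_1(x)=f_2(x)$ for almost every $x\in D$.
   Context: Let $T>0$ and let $D\subset\mathbb{R}^d$ ($d=1,2,3$) be a bounded domain with Lipschitz boundary. The operator $A$ is the symmetric uniformly elliptic operator with homogeneous Dirichlet boundary condition $Au(x)=\sum_{i,j=1}^d(a_{ij}(x)u_{x_i}(x))_{x_j}-c(x)u(x)$ for $u\in H^2(D)\cap H^1_0(D)$, where $c,a_{ij}\in C^1(\bar D)$, $c\ge 0$, $a_{ij}=a_{ji}$, and there is a constant $a_0>0$ with $a_0\sum_{i}\xi_i^2\le\sum_{i,j}a_{ij}(x)\xi_i\xi_j$ for all $x\in\bar D$, $\xi\in\mathbb{R}^d$. The eigensystem of $-A$ (with Dirichlet boundary conditions) is $\{\lambda_n,\varphi_n\}_{n\ge1}$, with $0<\lambda_1\le\lambda_2\le\cdots$, $\lambda_n\to\infty$, and $\{\varphi_n\}$ a complete orthonormal basis of $L^2(D)$, $A\varphi_n=-\lambda_n\varphi_n$. The process $w=\{w(t)\}_{t\ge0}$ is a standard real-valued Brownian motion on a complete filtered probability space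 $(\Omega,\mathcal{F},\{\mathcal{F}_t\}_{t\ge0},\mathbb{P})$. The functions $u_0,f_1,f_2,g$ depend only on $x$ and are deterministic; $R$ depends only on $t$ and is deterministic. For $v\in L^2(D)$ write $v_n=(v,\varphi_n)_{L^2(D)}$, and $u_{0,n}=(u_0,\varphi_n)_{L^2(D)}$. The mild solution of $du=Au\,dt+Rf\,dt+g\,dw$, $u(0)=u_0$, is the process $$u(x,t)=\sum_{n=1}^\infty\left(e^{-\lambda_nt}u_{0,n}+\int_0^te^{-\lambda_n(t-s)}R(s)f_n\,ds+\int_0^te^{-\lambda_n(t-s)}g_n\,dw(s)\right)\varphi_n(x),\quad\mathbb{P}\text{-a.s.}$$ *)

theory Defs
  imports "HOL-Probability.Probability"
begin

section \<open>Lipschitz domains and \<open>C\<^sup>1\<close> coefficients\<close>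

text \<open>Near each boundary point the set is the strict epigraph, in some direction \<open>\<nu>\<close>, of a
  Lipschitz function of the component orthogonal to \<open>\<nu>\<close>.  Only the values of \<open>\<gamma>\<close> on the hyperplane
  orthogonal to \<open>\<nu>\<close> matter; in dimension one that hyperplane is a point.\<close>

definition lipschitz_boundary :: "(real ^ 'd) set \<Rightarrow> bool" where
  "lipschitz_boundary D \<longleftrightarrow>
     (\<forall>p\<in>frontier D. \<exists>r>0. \<exists>\<nu>. \<exists>L. \<exists>\<gamma>.
        norm \<nu> = 1 \<and> L-lipschitz_on UNIV (\<gamma> :: real ^ 'd \<Rightarrow> real) \<and>
        D \<inter> ball p r = {x \<in> ball p r. \<gamma> (x - (x \<bullet> \<nu>) *\<^sub>R \<nu>) < x \<bullet> \<nu>})"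

definition bounded_lipschitz_domain :: "(real ^ 'd) set \<Rightarrow> bool" where
  "bounded_lipschitz_domain D \<longleftrightarrow>
     open D \<and> connected D \<and> D \<noteq> {} \<and> bounded D \<and> lipschitz_boundary D"

definition C1_closure :: "(real ^ 'd) set \<Rightarrow> (real ^ 'd \<Rightarrow> real) \<Rightarrow> bool" where
  "C1_closure D f \<longleftrightarrow> continuous_on (closure D) f \<and>
     (\<exists>f'. continuous_on (closure D) f' \<and>
           (\<forall>x\<in>D. (f has_derivative (\<lambda>h. f' x \<bullet> h)) (at x)))"


section \<open>\<open>L\<^sup>2(D)\<close> and Sobolev spaces\<close>

text \<open>Elements of \<open>L\<^sup>2(D)\<close> are represented by functions on the whole space; values outside \<open>D\<close> are
  irrelevant, and equality in \<open>L\<^sup>2(D)\<close> is equality almost everywhere in \<open>D\<close>.\<close>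

definition L2 :: "(real ^ 'd) set \<Rightarrow> (real ^ 'd \<Rightarrow> real) \<Rightarrow> bool" where
  "L2 D u \<longleftrightarrow> u \<in> borel_measurable (lebesgue_on D) \<and> integrable (lebesgue_on D) (\<lambda>x. (u x)\<^sup>2)"

definition L2_inner :: "(real ^ 'd) set \<Rightarrow> (real ^ 'd \<Rightarrow> real) \<Rightarrow> (real ^ 'd \<Rightarrow> real) \<Rightarrow> real" where
  "L2_inner D u v = (\<integral>x. u x * v x \<partial>lebesgue_on D)"

definition L2_tendsto ::
    "(real ^ 'd) set \<Rightarrow> (nat \<Rightarrow> real ^ 'd \<Rightarrow> real) \<Rightarrow> (real ^ 'd \<Rightarrow> real) \<Rightarrow> bool" where
  "L2_tendsto D v u \<longleftrightarrow> L2 D u \<and> (\<forall>k. L2 D (v k)) \<and>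
     (\<lambda>k. \<integral>x. (v k x - u x)\<^sup>2 \<partial>lebesgue_on D) \<longlonglongrightarrow> 0"

fun C_k :: "nat \<Rightarrow> (real ^ 'd \<Rightarrow> real) \<Rightarrow> bool" where
  "C_k 0 f \<longleftrightarrow> continuous_on UNIV f"
| "C_k (Suc k) f \<longleftrightarrow>
     (\<exists>f'. (\<forall>x. (f has_derivative (\<lambda>h. f' x \<bullet> h)) (at x)) \<and> (\<forall>i. C_k k (\<lambda>x. f' x $ i)))"

definition test_function :: "(real ^ 'd) set \<Rightarrow> (real ^ 'd \<Rightarrow> real) \<Rightarrow> bool" where
  "test_function D \<psi> \<longleftrightarrow> (\<forall>k. C_k k \<psi>) \<and>
     compact (closure {x. \<psi> x \<noteq> 0}) \<and> closure {x. \<psi> x \<noteq> 0} \<subseteq> D"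

definition partial_deriv :: "'d \<Rightarrow> (real ^ 'd \<Rightarrow> real) \<Rightarrow> real ^ 'd \<Rightarrow> real" where
  "partial_deriv i \<psi> x = frechet_derivative \<psi> (at x) (axis i 1)"

definition locally_integrable :: "(real ^ 'd) set \<Rightarrow> (real ^ 'd \<Rightarrow> real) \<Rightarrow> bool" where
  "locally_integrable D u \<longleftrightarrow> (\<forall>K. compact K \<and> K \<subseteq> D \<longrightarrow> set_integrable lebesgue K u)"

definition weak_partial_deriv ::
    "(real ^ 'd) set \<Rightarrow> 'd \<Rightarrow> (real ^ 'd \<Rightarrow> real) \<Rightarrow> (real ^ 'd \<Rightarrow> real) \<Rightarrow> bool" where
  "weak_partial_deriv D i u v \<longleftrightarrow> locally_integrable D u \<and> locally_integrable D v \<and>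
     (\<forall>\<psi>. test_function D \<psi> \<longrightarrow>
        (\<integral>x. u x * partial_deriv i \<psi> x \<partial>lebesgue_on D) = - (\<integral>x. v x * \<psi> x \<partial>lebesgue_on D))"

definition H1 :: "(real ^ 'd) set \<Rightarrow> (real ^ 'd \<Rightarrow> real) \<Rightarrow> bool" where
  "H1 D u \<longleftrightarrow> L2 D u \<and> (\<forall>i. \<exists>v. weak_partial_deriv D i u v \<and> L2 D v)"

definition H2 :: "(real ^ 'd) set \<Rightarrow> (real ^ 'd \<Rightarrow> real) \<Rightarrow> bool" where
  "H2 D u \<longleftrightarrow> L2 D u \<and> (\<forall>i. \<exists>v. weak_partial_deriv D i u v \<and> H1 D v)"

text \<open>\<open>H\<^sup>1\<^sub>0(D)\<close> is the closure of the test functions in \<open>H\<^sup>1(D)\<close>.\<close>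

definition H10 :: "(real ^ 'd) set \<Rightarrow> (real ^ 'd \<Rightarrow> real) \<Rightarrow> bool" where
  "H10 D u \<longleftrightarrow> L2 D u \<and>
     (\<exists>v \<psi>. (\<forall>i. weak_partial_deriv D i u (v i)) \<and> (\<forall>k. test_function D (\<psi> k)) \<and>
            L2_tendsto D \<psi> u \<and> (\<forall>i. L2_tendsto D (\<lambda>k. partial_deriv i (\<psi> k)) (v i)))"


section \<open>The elliptic operator and its eigensystem\<close>

definition elliptic_coeffs ::
    "(real ^ 'd) set \<Rightarrow> ('d \<Rightarrow> 'd \<Rightarrow> real ^ 'd \<Rightarrow> real) \<Rightarrow> (real ^ 'd \<Rightarrow> real) \<Rightarrow> bool" where
  "elliptic_coeffs D a c \<longleftrightarrow>
     C1_closure D c \<and> (\<forall>i j. C1_closure D (a i j)) \<and>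
     (\<forall>x\<in>closure D. 0 \<le> c x) \<and> (\<forall>i j. \<forall>x\<in>closure D. a i j x = a j i x) \<and>
     (\<exists>a0>0. \<forall>x\<in>closure D. \<forall>\<xi> :: real ^ 'd.
        a0 * (\<Sum>i\<in>UNIV. (\<xi> $ i)\<^sup>2) \<le> (\<Sum>i\<in>UNIV. \<Sum>j\<in>UNIV. a i j x * \<xi> $ i * \<xi> $ j))"

text \<open>\<open>elliptic_op D a c u h\<close>: \<open>u\<close> lies in the domain \<open>H\<^sup>2(D) \<inter> H\<^sup>1\<^sub>0(D)\<close> of \<open>A\<close> and \<open>A u = h\<close>
  almost everywhere in \<open>D\<close>.  Here \<open>p i\<close> is the weak derivative of \<open>u\<close> in direction \<open>i\<close>, and \<open>q i j\<close>
  that of \<open>a i j * p i\<close> in direction \<open>j\<close>.\<close>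

definition elliptic_op ::
    "(real ^ 'd) set \<Rightarrow> ('d \<Rightarrow> 'd \<Rightarrow> real ^ 'd \<Rightarrow> real) \<Rightarrow> (real ^ 'd \<Rightarrow> real) \<Rightarrow>
     (real ^ 'd \<Rightarrow> real) \<Rightarrow> (real ^ 'd \<Rightarrow> real) \<Rightarrow> bool" where
  "elliptic_op D a c u h \<longleftrightarrow> H2 D u \<and> H10 D u \<and>
     (\<exists>p q. (\<forall>i. weak_partial_deriv D i u (p i)) \<and>
            (\<forall>i j. weak_partial_deriv D j (\<lambda>x. a i j x * p i x) (q i j)) \<and>
            (AE x in lebesgue_on D. h x = (\<Sum>i\<in>UNIV. \<Sum>j\<in>UNIV. q i j x) - c x * u x))"

definition orthonormal_basis_L2 :: "(real ^ 'd) set \<Rightarrow> (nat \<Rightarrow> real ^ 'd \<Rightarrow> real) \<Rightarrow> bool" where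
  "orthonormal_basis_L2 D \<phi> \<longleftrightarrow>
     (\<forall>n. L2 D (\<phi> n)) \<and> (\<forall>m n. L2_inner D (\<phi> m) (\<phi> n) = (if m = n then 1 else 0)) \<and>
     (\<forall>v. L2 D v \<longrightarrow> L2_tendsto D (\<lambda>N x. \<Sum>n<N. L2_inner D v (\<phi> n) * \<phi> n x) v)"

text \<open>The index starts at 0, so \<open>lam n\<close> and \<open>\<phi> n\<close> stand for the \<open>(n + 1)\<close>-st eigenvalue and
  eigenfunction.\<close>

definition eigensystem ::
    "(real ^ 'd) set \<Rightarrow> ('d \<Rightarrow> 'd \<Rightarrow> real ^ 'd \<Rightarrow> real) \<Rightarrow> (real ^ 'd \<Rightarrow> real) \<Rightarrow>
     (nat \<Rightarrow> real) \<Rightarrow> (nat \<Rightarrow> real ^ 'd \<Rightarrow> real) \<Rightarrow> bool" where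
  "eigensystem D a c lam \<phi> \<longleftrightarrow>
     0 < lam 0 \<and> incseq lam \<and> filterlim lam at_top sequentially \<and>
     orthonormal_basis_L2 D \<phi> \<and> (\<forall>n. elliptic_op D a c (\<phi> n) (\<lambda>x. - lam n * \<phi> n x))"


section \<open>Brownian motion and the Ito integral\<close>

text \<open>Time is \<open>[0, \<infinity>)\<close>: the values of \<open>F\<close> and of processes at negative reals are never used.\<close>

definition complete_filtered_prob_space :: "'w measure \<Rightarrow> (real \<Rightarrow> 'w measure) \<Rightarrow> bool" where
  "complete_filtered_prob_space M F \<longleftrightarrow>
     prob_space M \<and> complete_measure M \<and> filtration (space M) (\<lambda>t. F (max 0 t)) \<and>
     (\<forall>t\<ge>0. sets (F t) \<subseteq> sets M) \<and> null_sets M \<subseteq> sets (F 0)"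

definition brownian_motion ::
    "'w measure \<Rightarrow> (real \<Rightarrow> 'w measure) \<Rightarrow> (real \<Rightarrow> 'w \<Rightarrow> real) \<Rightarrow> bool" where
  "brownian_motion M F w \<longleftrightarrow>
     (\<forall>t\<ge>0. w t \<in> borel_measurable (F t)) \<and>
     (AE \<omega> in M. w 0 \<omega> = 0) \<and>
     (AE \<omega> in M. continuous_on {0..} (\<lambda>t. w t \<omega>)) \<and>
     (\<forall>s t. 0 \<le> s \<and> s < t \<longrightarrow>
        distributed M lborel (\<lambda>\<omega>. w t \<omega> - w s \<omega>) (normal_density 0 (sqrt (t - s))) \<and>
        prob_space.indep_set M (sets (F s))
          {(\<lambda>\<omega>. w t \<omega> - w s \<omega>) -` B \<inter> space M | B. B \<in> sets borel})"

text \<open>A simple process on \<open>(0, t]\<close> with partition points \<open>\<tau> 0 \<le> \<dots> \<le> \<tau> m\<close> takes the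
  \<open>F (\<tau> k)\<close>-measurable value \<open>\<xi> k\<close> on \<open>(\<tau> k, \<tau> (k + 1)]\<close>.\<close>

definition simple_process ::
    "(real \<Rightarrow> 'w measure) \<Rightarrow> real \<Rightarrow> nat \<Rightarrow> (nat \<Rightarrow> real) \<Rightarrow> (nat \<Rightarrow> 'w \<Rightarrow> real) \<Rightarrow> bool" where
  "simple_process F t m \<tau> \<xi> \<longleftrightarrow>
     0 \<le> \<tau> 0 \<and> \<tau> m \<le> t \<and>
     (\<forall>k<m. \<tau> k \<le> \<tau> (Suc k) \<and> \<xi> k \<in> borel_measurable (F (\<tau> k)) \<and>
            (\<exists>C. \<forall>\<omega>\<in>space (F (\<tau> k)). \<bar>\<xi> k \<omega>\<bar> \<le> C))"

definition simple_process_val ::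
    "nat \<Rightarrow> (nat \<Rightarrow> real) \<Rightarrow> (nat \<Rightarrow> 'w \<Rightarrow> real) \<Rightarrow> real \<Rightarrow> 'w \<Rightarrow> real" where
  "simple_process_val m \<tau> \<xi> s \<omega> = (\<Sum>k<m. \<xi> k \<omega> * indicator {\<tau> k<..\<tau> (Suc k)} s)"

definition simple_ito_integral ::
    "(real \<Rightarrow> 'w \<Rightarrow> real) \<Rightarrow> nat \<Rightarrow> (nat \<Rightarrow> real) \<Rightarrow> (nat \<Rightarrow> 'w \<Rightarrow> real) \<Rightarrow> 'w \<Rightarrow> real" where
  "simple_ito_integral w m \<tau> \<xi> \<omega> = (\<Sum>k<m. \<xi> k \<omega> * (w (\<tau> (Suc k)) \<omega> - w (\<tau> k) \<omega>))"

text \<open>\<open>is_ito_integral M F w t h I\<close>: the random variable \<open>I\<close> is a version of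
  \<open>\<integral>\<^sub>0\<^sup>t h(s) dw(s)\<close>, i.e. the \<open>L\<^sup>2(\<Omega>)\<close>-limit of the integrals of simple processes converging to
  \<open>h\<close> in \<open>L\<^sup>2([0, t] \<times> \<Omega>)\<close>.\<close>

definition is_ito_integral ::
    "'w measure \<Rightarrow> (real \<Rightarrow> 'w measure) \<Rightarrow> (real \<Rightarrow> 'w \<Rightarrow> real) \<Rightarrow> real \<Rightarrow>
     (real \<Rightarrow> 'w \<Rightarrow> real) \<Rightarrow> ('w \<Rightarrow> real) \<Rightarrow> bool" where
  "is_ito_integral M F w t h I \<longleftrightarrow>
     (\<lambda>(s, \<omega>). h s \<omega>) \<in> borel_measurable (restrict_space lborel {0..t} \<Otimes>\<^sub>M M) \<and>
     I \<in> borel_measurable M \<and>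
     (\<exists>m \<tau> \<xi>. (\<forall>j. simple_process F t (m j) (\<tau> j) (\<xi> j)) \<and>
        (\<lambda>j. \<integral>\<^sup>+(s, \<omega>). ennreal ((h s \<omega> - simple_process_val (m j) (\<tau> j) (\<xi> j) s \<omega>)\<^sup>2)
               \<partial>(restrict_space lborel {0..t} \<Otimes>\<^sub>M M)) \<longlonglongrightarrow> 0 \<and>
        (\<lambda>j. \<integral>\<^sup>+\<omega>. ennreal ((I \<omega> - simple_ito_integral w (m j) (\<tau> j) (\<xi> j) \<omega>)\<^sup>2) \<partial>M)
           \<longlonglongrightarrow> 0)"


section \<open>Mild solutions\<close>

text \<open>\<open>mild_coeff\<close> is the coefficient of the solution along an eigenfunction with eigenvalue \<open>l\<close>;
  \<open>u0n\<close> and \<open>fn\<close> are the coefficients of the data and \<open>I\<close> is the stochastic integral.\<close>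

definition mild_coeff :: "(real \<Rightarrow> real) \<Rightarrow> real \<Rightarrow> real \<Rightarrow> real \<Rightarrow> real \<Rightarrow> real \<Rightarrow> real" where
  "mild_coeff R t l u0n fn I =
     exp (- l * t) * u0n + (LINT s:{0..t}|lebesgue. exp (- l * (t - s)) * R s * fn) + I"

text \<open>The solution is a jointly measurable process \<open>u x t \<omega>\<close> whose eigenfunction series converges
  to it in \<open>L\<^sup>2(D)\<close>, almost surely for each time.  \<open>I n t\<close> is any version of
  \<open>\<integral>\<^sub>0\<^sup>t exp (-\<lambda>\<^sub>n (t - s)) g\<^sub>n dw(s)\<close>.\<close>

definition mild_solution ::
    "(real ^ 'd) set \<Rightarrow> real \<Rightarrow> (nat \<Rightarrow> real) \<Rightarrow> (nat \<Rightarrow> real ^ 'd \<Rightarrow> real) \<Rightarrow>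
     'w measure \<Rightarrow> (real \<Rightarrow> 'w measure) \<Rightarrow> (real \<Rightarrow> 'w \<Rightarrow> real) \<Rightarrow>
     (real ^ 'd \<Rightarrow> real) \<Rightarrow> (real \<Rightarrow> real) \<Rightarrow> (real ^ 'd \<Rightarrow> real) \<Rightarrow> (real ^ 'd \<Rightarrow> real) \<Rightarrow>
     (real ^ 'd \<Rightarrow> real \<Rightarrow> 'w \<Rightarrow> real) \<Rightarrow> bool" where
  "mild_solution D T lam \<phi> M F w u0 R f g u \<longleftrightarrow>
     (\<forall>t\<in>{0..T}. (\<lambda>(x, \<omega>). u x t \<omega>) \<in> borel_measurable (lebesgue_on D \<Otimes>\<^sub>M M)) \<and>
     (\<exists>I. (\<forall>n. \<forall>t\<in>{0..T}. is_ito_integral M F w t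
              (\<lambda>s \<omega>. exp (- lam n * (t - s)) * L2_inner D g (\<phi> n)) (I n t)) \<and>
          (\<forall>t\<in>{0..T}. AE \<omega> in M. L2_tendsto D
              (\<lambda>N x. \<Sum>n<N. mild_coeff R t (lam n) (L2_inner D u0 (\<phi> n))
                                (L2_inner D f (\<phi> n)) (I n t \<omega>) * \<phi> n x)
              (\<lambda>x. u x t \<omega>)))"

end

theory Submission
  imports Defs
begin

text \<open>The mean of a mild solution at time \<open>T\<close> has the eigenfunction coefficients
  \<open>exp (-\<lambda>\<^sub>n T) u\<^sub>0\<^sub>,\<^sub>n + f\<^sub>n \<integral>\<^sub>0\<^sup>T exp (-\<lambda>\<^sub>n (T - s)) R(s) ds\<close>, since Ito integrals have mean zero.  The
  integral is positive because \<open>R \<ge> c\<^sub>R > 0\<close>, so the mean determines every \<open>f\<^sub>n\<close>.  The exchange of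
  expectation and eigenfunction coefficient rests on \<open>u(\<cdot>, T) \<in> L\<^sup>2(D \<times> \<Omega>)\<close>, which follows from
  Parseval's identity and a bound for the second moments of the Ito integrals.\<close>

section \<open>Square-integrable functions\<close>

text \<open>Square integrability on the product space requires second moments of the coefficients
  that are summable in n. The exponential factors are at most 1, so summability is inherited from
  the data: the squared coefficients of the initial value, the source and the noise form convergent
  series. About an Ito integral one knows only that approximating simple processes exist, and their
  partitions may change freely from one approximant to the next. Hence moments are computed exactly
  for a single simple process, and the limit is reached by estimates that compare the integral with
  one approximant at a time. The two solutions may rest on different versions of the stochastic
  integrals; since only moments of these versions enter, the versions never have to be
  identified.\<close>

lemma integrable_mult_of_squares:
  fixes f g :: "'a \<Rightarrow> real"
  assumes "f \<in> borel_measurable N" "g \<in> borel_measurable N"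
    and "integrable N (\<lambda>x. (f x)\<^sup>2)" "integrable N (\<lambda>x. (g x)\<^sup>2)"
  shows "integrable N (\<lambda>x. f x * g x)"
proof (rule Bochner_Integration.integrable_bound)
  show "integrable N (\<lambda>x. (f x)\<^sup>2 + (g x)\<^sup>2)" using assms by simp
  show "(\<lambda>x. f x * g x) \<in> borel_measurable N" using assms by simp
  have "\<bar>r * s\<bar> \<le> r\<^sup>2 + s\<^sup>2" for r s :: real
  proof -
    have "2 * \<bar>r * s\<bar> \<le> r\<^sup>2 + s\<^sup>2"
      using sum_squares_bound[of "\<bar>r\<bar>" "\<bar>s\<bar>"] by (simp add: abs_mult)
    then show ?thesis using abs_ge_zero[of "r * s"] by linarith
  qed
  then show "AE x in N. norm (f x * g x) \<le> norm ((f x)\<^sup>2 + (g x)\<^sup>2)" by simp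
qed

text \<open>The integral of the square of \<open>?C * f x - ?B * g x\<close> equals
  \<open>?C * (?A * ?C - ?B\<^sup>2)\<close> and is nonnegative. Dividing by \<open>?C\<close>
  requires \<open>?C\<close> to be nonzero; otherwise \<open>g\<close> vanishes almost everywhere
  and so does the pairing.\<close>

lemma Cauchy_Schwarz_integral:
  fixes f g :: "'a \<Rightarrow> real"
  assumes [measurable]: "f \<in> borel_measurable N" "g \<in> borel_measurable N"
    and f: "integrable N (\<lambda>x. (f x)\<^sup>2)" and g: "integrable N (\<lambda>x. (g x)\<^sup>2)"
  shows "(\<integral>x. f x * g x \<partial>N)\<^sup>2 \<le> (\<integral>x. (f x)\<^sup>2 \<partial>N) * (\<integral>x. (g x)\<^sup>2 \<partial>N)"
proof -
  let ?A = "\<integral>x. (f x)\<^sup>2 \<partial>N" and ?B = "\<integral>x. f x * g x \<partial>N" and ?C = "\<integral>x. (g x)\<^sup>2 \<partial>N"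
  note fg = integrable_mult_of_squares[OF assms]
  have "0 \<le> (\<integral>x. (?C * f x - ?B * g x)\<^sup>2 \<partial>N)" by simp
  also have "\<dots> = (\<integral>x. ?C\<^sup>2 * (f x)\<^sup>2 - 2 * ?B * ?C * (f x * g x) + ?B\<^sup>2 * (g x)\<^sup>2 \<partial>N)"
    by (intro Bochner_Integration.integral_cong refl) (simp add: power2_eq_square algebra_simps)
  also have "\<dots> = ?C\<^sup>2 * ?A - 2 * ?B * ?C * ?B + ?B\<^sup>2 * ?C"
    using f g fg by simp
  also have "\<dots> = ?C * (?A * ?C - ?B\<^sup>2)" by (simp add: power2_eq_square algebra_simps)
  finally have *: "0 \<le> ?C * (?A * ?C - ?B\<^sup>2)" .
  show ?thesis
  proof (cases "?C = 0")
    case True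
    then have "AE x in N. (g x)\<^sup>2 = 0"
      using integral_nonneg_eq_0_iff_AE[OF g] by simp
    then have "?B = (\<integral>x. 0 \<partial>N)"
      by (intro integral_cong_AE) auto
    then show ?thesis by simp
  next
    case False
    moreover have "0 \<le> ?C" by simp
    ultimately have "0 < ?C" by linarith
    then show ?thesis using * by (simp add: zero_le_mult_iff)
  qed
qed

lemma L2_measurable: "L2 D u \<Longrightarrow> u \<in> borel_measurable (lebesgue_on D)"
  by (simp add: L2_def)

lemma L2_integrable_power2: "L2 D u \<Longrightarrow> integrable (lebesgue_on D) (\<lambda>x. (u x)\<^sup>2)"
  by (simp add: L2_def)

lemma L2_integrable_mult: "L2 D u \<Longrightarrow> L2 D v \<Longrightarrow> integrable (lebesgue_on D) (\<lambda>x. u x * v x)"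
  by (simp add: L2_def integrable_mult_of_squares)

lemma L2_diff:
  assumes "L2 D u" "L2 D v" shows "L2 D (\<lambda>x. u x - v x)"
  using assms L2_integrable_mult[OF assms]
  by (auto simp: L2_def power2_diff mult.assoc)

text \<open>Norm convergence is exploited only through this continuity of the pairing: uniqueness of
  limits, the coefficient formula and Parseval's identity all follow by a suitable choice of
  \<open>p\<close>.\<close>

lemma L2_inner_tendsto:
  assumes v: "L2_tendsto D v u" and p: "L2 D p"
  shows "(\<lambda>k. L2_inner D (v k) p) \<longlonglongrightarrow> L2_inner D u p"
proof -
  have L: "L2 D u" "\<And>k. L2 D (v k)" and lim: "(\<lambda>k. \<integral>x. (v k x - u x)\<^sup>2 \<partial>lebesgue_on D) \<longlonglongrightarrow> 0"
    using v by (auto simp: L2_tendsto_def)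
  have "(L2_inner D (v k) p - L2_inner D u p)\<^sup>2
      \<le> (\<integral>x. (v k x - u x)\<^sup>2 \<partial>lebesgue_on D) * (\<integral>x. (p x)\<^sup>2 \<partial>lebesgue_on D)" for k
  proof -
    have "L2_inner D (v k) p - L2_inner D u p = (\<integral>x. (v k x - u x) * p x \<partial>lebesgue_on D)"
      using L p by (simp add: L2_inner_def left_diff_distrib L2_integrable_mult)
    then show ?thesis
      using Cauchy_Schwarz_integral[of "\<lambda>x. v k x - u x" _ p] L2_diff[OF L(2) L(1)] p
      by (simp add: L2_def)
  qed
  then have le: "\<forall>\<^sub>F k in sequentially. (L2_inner D (v k) p - L2_inner D u p)\<^sup>2
      \<le> (\<integral>x. (v k x - u x)\<^sup>2 \<partial>lebesgue_on D) * (\<integral>x. (p x)\<^sup>2 \<partial>lebesgue_on D)"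
    by (intro always_eventually allI)
  have "(\<lambda>k. (\<integral>x. (v k x - u x)\<^sup>2 \<partial>lebesgue_on D) * (\<integral>x. (p x)\<^sup>2 \<partial>lebesgue_on D)) \<longlonglongrightarrow> 0"
    using tendsto_mult_left_zero[OF lim] .
  then have "(\<lambda>k. (L2_inner D (v k) p - L2_inner D u p)\<^sup>2) \<longlonglongrightarrow> 0"
    by (rule tendsto_sandwich[OF always_eventually le tendsto_const, rotated]) simp
  then have "(\<lambda>k. L2_inner D (v k) p - L2_inner D u p) \<longlonglongrightarrow> 0"
    by (simp add: power_tendsto_0_iff)
  then show ?thesis by (simp add: LIM_zero_iff)
qed

text \<open>Pairing the sequence with \<open>u - v\<close> gives the same limit for \<open>u\<close>
  and for \<open>v\<close>, so the norm of the difference is zero.\<close>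

lemma L2_tendsto_unique:
  assumes u: "L2_tendsto D s u" and v: "L2_tendsto D s v"
  shows "AE x in lebesgue_on D. u x = v x"
proof -
  have L: "L2 D u" "L2 D v" "\<And>k. L2 D (s k)"
    using u v by (auto simp: L2_tendsto_def)
  have d: "L2 D (\<lambda>x. u x - v x)" by (rule L2_diff[OF L(1,2)])
  have "L2_inner D (\<lambda>x. u x - v x) (\<lambda>x. u x - v x)
      = L2_inner D u (\<lambda>x. u x - v x) - L2_inner D v (\<lambda>x. u x - v x)"
    using L(1,2) d by (simp add: L2_inner_def left_diff_distrib L2_integrable_mult)
  also have "\<dots> = 0"
    using LIMSEQ_unique[OF L2_inner_tendsto[OF u d] L2_inner_tendsto[OF v d]] by simp
  finally have "(\<integral>x. (u x - v x)\<^sup>2 \<partial>lebesgue_on D) = 0"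
    by (simp add: L2_inner_def power2_eq_square)
  then have "AE x in lebesgue_on D. (u x - v x)\<^sup>2 = 0"
    using integral_nonneg_eq_0_iff_AE[OF L2_integrable_power2[OF d]] by simp
  then show ?thesis by simp
qed

subsection \<open>Orthonormal expansions\<close>

lemma L2_inner_orthonormal_sum:
  fixes \<phi> :: "nat \<Rightarrow> real ^ 'd \<Rightarrow> real"
  assumes \<phi>: "\<And>n. L2 D (\<phi> n)"
    and on: "\<And>m n. L2_inner D (\<phi> m) (\<phi> n) = (if m = n then 1 else 0)"
  shows "L2_inner D (\<lambda>x. \<Sum>n<N. b n * \<phi> n x) (\<phi> m) = (if m < N then b m else 0)"
proof -
  have "L2_inner D (\<lambda>x. \<Sum>n<N. b n * \<phi> n x) (\<phi> m) = (\<Sum>n<N. b n * L2_inner D (\<phi> n) (\<phi> m))"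
    using \<phi> by (simp add: L2_inner_def sum_distrib_right mult.assoc L2_integrable_mult)
  also have "\<dots> = (\<Sum>n<N. if n = m then b n else 0)"
    by (intro sum.cong) (auto simp: on)
  finally show ?thesis by (simp add: sum.delta)
qed

text \<open>The pairing of the partial sums with \<open>\<phi> m\<close> is constantly
  \<open>b m\<close> as soon as \<open>N\<close> exceeds \<open>m\<close>.\<close>

lemma orthonormal_expansion_coeff:
  fixes \<phi> :: "nat \<Rightarrow> real ^ 'd \<Rightarrow> real"
  assumes \<phi>: "\<And>n. L2 D (\<phi> n)"
    and on: "\<And>m n. L2_inner D (\<phi> m) (\<phi> n) = (if m = n then 1 else 0)"
    and u: "L2_tendsto D (\<lambda>N x. \<Sum>n<N. b n * \<phi> n x) u"
  shows "L2_inner D u (\<phi> m) = b m"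
proof (rule LIMSEQ_unique[OF L2_inner_tendsto[OF u \<phi>]])
  show "(\<lambda>N. L2_inner D (\<lambda>x. \<Sum>n<N. b n * \<phi> n x) (\<phi> m)) \<longlonglongrightarrow> b m"
    unfolding L2_inner_orthonormal_sum[OF \<phi> on]
    by (rule tendsto_eventually, rule eventually_mono[OF eventually_gt_at_top[of m]]) simp
qed

text \<open>The partial sums are paired with the limit \<open>u\<close> itself: by the coefficient
  formula this gives the partial sums of the squares, and continuity of the pairing gives the
  squared norm of \<open>u\<close> as their limit.\<close>

lemma Parseval:
  fixes \<phi> :: "nat \<Rightarrow> real ^ 'd \<Rightarrow> real"
  assumes \<phi>: "\<And>n. L2 D (\<phi> n)"
    and on: "\<And>m n. L2_inner D (\<phi> m) (\<phi> n) = (if m = n then 1 else 0)"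
    and u: "L2_tendsto D (\<lambda>N x. \<Sum>n<N. b n * \<phi> n x) u"
  shows "(\<lambda>n. (b n)\<^sup>2) sums (\<integral>x. (u x)\<^sup>2 \<partial>lebesgue_on D)"
proof -
  have L: "L2 D u" using u by (simp add: L2_tendsto_def)
  have "L2_inner D (\<lambda>x. \<Sum>n<N. b n * \<phi> n x) u = (\<Sum>n<N. (b n)\<^sup>2)" for N
  proof -
    have "L2_inner D (\<lambda>x. \<Sum>n<N. b n * \<phi> n x) u = (\<Sum>n<N. b n * L2_inner D (\<phi> n) u)"
      using \<phi> L by (simp add: L2_inner_def sum_distrib_right mult.assoc L2_integrable_mult)
    also have "\<dots> = (\<Sum>n<N. b n * L2_inner D u (\<phi> n))"
      by (simp add: L2_inner_def mult.commute)
    finally show ?thesis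
      by (simp add: orthonormal_expansion_coeff[OF \<phi> on u] power2_eq_square)
  qed
  with L2_inner_tendsto[OF u L] show ?thesis
    by (simp add: sums_def L2_inner_def power2_eq_square)
qed

section \<open>Moments of the Ito integral\<close>

lemma filtration_measurable:
  assumes "complete_filtered_prob_space M F" and "0 \<le> s" and "s \<le> t"
    and "X \<in> borel_measurable (F s)"
  shows "X \<in> borel_measurable (F t)"
proof -
  \<comment> \<open>Truncation at 0 means that monotonicity of \<open>F\<close> is known at
    nonnegative times only, which is where \<open>0 \<le> s\<close> enters.\<close>
  interpret filtration "space M" "\<lambda>t. F (max 0 t)"
    using assms(1) by (simp add: complete_filtered_prob_space_def)
  have "space (F s) = space M" "space (F t) = space M" "sets (F s) \<subseteq> sets (F t)"
    using space_F[of s] space_F[of t] sets_F_mono[of s t] assms(2,3) by (auto simp: max_def)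
  then show ?thesis using assms(4) by (auto simp: measurable_def)
qed

lemma filtration_measurable_M:
  assumes "complete_filtered_prob_space M F" and "0 \<le> s" and "X \<in> borel_measurable (F s)"
  shows "X \<in> borel_measurable M"
proof -
  interpret filtration "space M" "\<lambda>t. F (max 0 t)"
    using assms(1) by (simp add: complete_filtered_prob_space_def)
  have "space (F s) = space M" "sets (F s) \<subseteq> sets M"
    using space_F[of s] assms(1,2) by (auto simp: max_def complete_filtered_prob_space_def)
  then show ?thesis using assms(3) by (auto simp: measurable_def)
qed

context
  fixes M :: "'w measure" and F :: "real \<Rightarrow> 'w measure" and w :: "real \<Rightarrow> 'w \<Rightarrow> real"
  assumes M: "complete_filtered_prob_space M F" and w: "brownian_motion M F w"
begin

interpretation prob_space M
  using M by (simp add: complete_filtered_prob_space_def)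

section \<open>Moments and independence of Brownian increments\<close>

lemma brownian_measurable: "0 \<le> t \<Longrightarrow> w t \<in> borel_measurable (F t)"
  using w by (simp add: brownian_motion_def)

lemma brownian_increment_moments:
  assumes "0 \<le> s" "s \<le> t"
  shows "integrable M (\<lambda>\<omega>. w t \<omega> - w s \<omega>)"
    and "expectation (\<lambda>\<omega>. w t \<omega> - w s \<omega>) = 0"
    and "integrable M (\<lambda>\<omega>. (w t \<omega> - w s \<omega>)\<^sup>2)"
    and "expectation (\<lambda>\<omega>. (w t \<omega> - w s \<omega>)\<^sup>2) = t - s"
proof -
  have "integrable M (\<lambda>\<omega>. w t \<omega> - w s \<omega>) \<and> expectation (\<lambda>\<omega>. w t \<omega> - w s \<omega>) = 0 \<and>
    integrable M (\<lambda>\<omega>. (w t \<omega> - w s \<omega>)\<^sup>2) \<and> expectation (\<lambda>\<omega>. (w t \<omega> - w s \<omega>)\<^sup>2) = t - s"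
  \<comment> \<open>The normal law is prescribed for \<open>s < t\<close> only. Equal times have to
    be covered as well, because neighbouring partition points of a simple process may
    coincide.\<close>
  proof (cases "s = t")
    case False
    define \<sigma> where "\<sigma> = sqrt (t - s)"
    have pos: "0 < \<sigma>" and sq: "\<sigma>\<^sup>2 = t - s" using assms False by (auto simp: \<sigma>_def)
    have D: "distributed M lborel (\<lambda>\<omega>. w t \<omega> - w s \<omega>) (normal_density 0 \<sigma>)"
      using w assms False by (simp add: brownian_motion_def \<sigma>_def)
    have E: "expectation (\<lambda>\<omega>. w t \<omega> - w s \<omega>) = 0"
      by (rule normal_distributed_expectation[OF pos D])
    have "integrable M (\<lambda>\<omega>. w t \<omega> - w s \<omega>)"
      using integrable_normal_moment[OF pos, of 0 1] distributed_integrable[OF D, of "\<lambda>x. x"] by simp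
    moreover have "integrable M (\<lambda>\<omega>. (w t \<omega> - w s \<omega>)\<^sup>2)"
      using integrable_normal_moment[OF pos, of 0 2] distributed_integrable[OF D, of "\<lambda>x. x\<^sup>2"] by simp
    moreover have "expectation (\<lambda>\<omega>. (w t \<omega> - w s \<omega>)\<^sup>2) = t - s"
      using normal_distributed_variance[OF pos D] by (simp add: E sq)
    ultimately show ?thesis using E by simp
  qed simp
  then show "integrable M (\<lambda>\<omega>. w t \<omega> - w s \<omega>)"
    and "expectation (\<lambda>\<omega>. w t \<omega> - w s \<omega>) = 0"
    and "integrable M (\<lambda>\<omega>. (w t \<omega> - w s \<omega>)\<^sup>2)"
    and "expectation (\<lambda>\<omega>. (w t \<omega> - w s \<omega>)\<^sup>2) = t - s"
    by auto
qed

text \<open>Independence is given for \<open>F s\<close> and the preimages under the increment,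
  whereas \<open>indep_var\<close> speaks of the generated sigma-algebras. The preimages are closed
  under intersection, so independence extends to the sigma-algebras; then \<open>F s\<close> is
  shrunk to the one generated by \<open>X\<close>.\<close>

lemma brownian_increment_indep:
  assumes "0 \<le> s" "s < t" and X: "X \<in> borel_measurable (F s)"
  shows "indep_var borel X borel (\<lambda>\<omega>. w t \<omega> - w s \<omega>)"
proof -
  interpret filtration "space M" "\<lambda>t. F (max 0 t)"
    using M by (simp add: complete_filtered_prob_space_def)
  have sp: "space (F s) = space M" using space_F[of s] assms(1) by (simp add: max_def)
  let ?Y = "\<lambda>\<omega>. w t \<omega> - w s \<omega>"
  let ?B = "{?Y -` B \<inter> space M | B. B \<in> sets borel}"
  have XM: "X \<in> borel_measurable M"
    by (rule filtration_measurable_M[OF M assms(1) X])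
  have YM: "?Y \<in> borel_measurable M"
    using brownian_increment_moments(1)[of s t] assms by auto
  have ind: "indep_set (sets (F s)) ?B"
    using w assms by (simp add: brownian_motion_def)
  have "Int_stable ?B"
  proof (rule Int_stableI)
    fix a b assume "a \<in> ?B" "b \<in> ?B"
    then obtain A B where "A \<in> sets borel" "B \<in> sets borel"
        "a = ?Y -` A \<inter> space M" "b = ?Y -` B \<inter> space M" by blast
    then have "a \<inter> b = ?Y -` (A \<inter> B) \<inter> space M" "A \<inter> B \<in> sets borel" by auto
    then show "a \<inter> b \<in> ?B" by blast
  qed
  then have "indep_set (sigma_sets (space M) (sets (F s))) (sigma_sets (space M) ?B)"
    by (intro indep_set_sigma_sets ind sets.Int_stable)
  then have "indep_set (sigma_sets (space M) {X -` A \<inter> space M | A. A \<in> sets borel})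
      (sigma_sets (space M) ?B)"
    unfolding indep_set_def
  proof (rule indep_sets_mono_sets)
    fix i :: bool
    have "{X -` A \<inter> space M | A. A \<in> sets borel} \<subseteq> sets (F s)"
      using measurable_sets[OF X] sp by auto
    then show "case_bool (sigma_sets (space M) {X -` A \<inter> space M | A. A \<in> sets borel})
        (sigma_sets (space M) ?B) i
      \<subseteq> case_bool (sigma_sets (space M) (sets (F s))) (sigma_sets (space M) ?B) i"
      by (cases i) (auto dest: sigma_sets_mono'[THEN subsetD])
  qed
  then show ?thesis using XM YM unfolding indep_var_eq by simp
qed

text \<open>Independence factors the expectations, and the increment has first moment 0 and second
  moment \<open>t - s\<close>. The admissible factors \<open>X\<close> are those that arise when one
  more interval is added to a simple integral.\<close>

lemma brownian_increment_product:
  assumes s: "0 \<le> s" "s \<le> t" and X: "X \<in> borel_measurable (F s)" and iX: "integrable M X"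
  shows "integrable M (\<lambda>\<omega>. X \<omega> * (w t \<omega> - w s \<omega>))"
    and "expectation (\<lambda>\<omega>. X \<omega> * (w t \<omega> - w s \<omega>)) = 0"
    and "integrable M (\<lambda>\<omega>. X \<omega> * (w t \<omega> - w s \<omega>)\<^sup>2)"
    and "expectation (\<lambda>\<omega>. X \<omega> * (w t \<omega> - w s \<omega>)\<^sup>2) = (t - s) * expectation X"
proof -
  note m = brownian_increment_moments[OF s]
  have "integrable M (\<lambda>\<omega>. X \<omega> * (w t \<omega> - w s \<omega>)) \<and>
    expectation (\<lambda>\<omega>. X \<omega> * (w t \<omega> - w s \<omega>)) = 0 \<and>
    integrable M (\<lambda>\<omega>. X \<omega> * (w t \<omega> - w s \<omega>)\<^sup>2) \<and>
    expectation (\<lambda>\<omega>. X \<omega> * (w t \<omega> - w s \<omega>)\<^sup>2) = (t - s) * expectation X"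
  proof (cases "s = t")
    case False
    then have ind: "indep_var borel X borel (\<lambda>\<omega>. w t \<omega> - w s \<omega>)"
      using brownian_increment_indep[OF s(1) _ X] s by simp
    have ind2: "indep_var borel X borel (\<lambda>\<omega>. (w t \<omega> - w s \<omega>)\<^sup>2)"
      using indep_var_compose[OF ind, of "\<lambda>x. x" borel "\<lambda>x. x\<^sup>2" borel] by (simp add: comp_def)
    show ?thesis
      using indep_var_integrable[OF ind iX m(1)] indep_var_lebesgue_integral[OF ind iX m(1)]
        indep_var_integrable[OF ind2 iX m(3)] indep_var_lebesgue_integral[OF ind2 iX m(3)] m
      by simp
  qed simp
  then show "integrable M (\<lambda>\<omega>. X \<omega> * (w t \<omega> - w s \<omega>))"
    and "expectation (\<lambda>\<omega>. X \<omega> * (w t \<omega> - w s \<omega>)) = 0"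
    and "integrable M (\<lambda>\<omega>. X \<omega> * (w t \<omega> - w s \<omega>)\<^sup>2)"
    and "expectation (\<lambda>\<omega>. X \<omega> * (w t \<omega> - w s \<omega>)\<^sup>2) = (t - s) * expectation X"
    by auto
qed

section \<open>Simple processes and the moments of their integrals\<close>

lemma simple_process_Suc: "simple_process F t (Suc m) \<tau> \<xi> \<Longrightarrow> simple_process F t m \<tau> \<xi>"
  by (force simp: simple_process_def)

lemma simple_process_partition:
  assumes "simple_process F t m \<tau> \<xi>" "k \<le> m"
  shows "0 \<le> \<tau> k" "\<tau> k \<le> \<tau> m"
proof -
  have mono: "\<tau> j \<le> \<tau> (Suc j)" if "j < m" for j
    using assms(1) that by (simp add: simple_process_def)
  have "\<tau> 0 \<le> \<tau> k" using assms(2)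
  proof (induction k)
    case (Suc k)
    then show ?case using mono[of k] by simp
  qed simp
  then show "0 \<le> \<tau> k" using assms(1) by (simp add: simple_process_def)
  show "\<tau> k \<le> \<tau> m" using assms(2)
    by (induction rule: inc_induct) (auto intro: order_trans mono)
qed

lemma simple_process_measurable:
  assumes "simple_process F t m \<tau> \<xi>" "k < m"
  shows "\<xi> k \<in> borel_measurable M"
  using assms simple_process_partition[OF assms(1), of k]
  by (intro filtration_measurable_M[OF M, of "\<tau> k"]) (auto simp: simple_process_def)

lemma simple_process_integrable:
  assumes "simple_process F t m \<tau> \<xi>" "k < m"
  shows "integrable M (\<xi> k)" and "integrable M (\<lambda>\<omega>. (\<xi> k \<omega>)\<^sup>2)"
proof -
  interpret filtration "space M" "\<lambda>t. F (max 0 t)"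
    using M by (simp add: complete_filtered_prob_space_def)
  have "space (F (\<tau> k)) = space M"
    using space_F[of "\<tau> k"] simple_process_partition[OF assms(1), of k] assms(2) by (simp add: max_def)
  \<comment> \<open>Boundedness is assumed on the space of \<open>F (\<tau> k)\<close>, which
    coincides with that of \<open>M\<close>; on a probability space it yields all moments.\<close>
  then obtain C where C: "\<And>\<omega>. \<omega> \<in> space M \<Longrightarrow> \<bar>\<xi> k \<omega>\<bar> \<le> C"
    using assms unfolding simple_process_def by metis
  have [measurable]: "\<xi> k \<in> borel_measurable M" by (rule simple_process_measurable[OF assms])
  show "integrable M (\<xi> k)"
    by (rule integrable_const_bound[of _ C]) (use C in auto)
  show "integrable M (\<lambda>\<omega>. (\<xi> k \<omega>)\<^sup>2)"
  proof (rule integrable_const_bound[of _ "C\<^sup>2"])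
    show "AE \<omega> in M. norm ((\<xi> k \<omega>)\<^sup>2) \<le> C\<^sup>2"
    proof (rule AE_I2)
      fix \<omega> assume "\<omega> \<in> space M"
      then show "norm ((\<xi> k \<omega>)\<^sup>2) \<le> C\<^sup>2"
        using power_mono[OF C, of \<omega> 2] by simp
    qed
  qed simp
qed

text \<open>Measurability at the last partition point, and not merely at \<open>t\<close>, is what
  makes the integral independent of the next increment in the induction for the isometry.\<close>

lemma simple_ito_integral_measurable:
  assumes "simple_process F t m \<tau> \<xi>"
  shows "simple_ito_integral w m \<tau> \<xi> \<in> borel_measurable (F (\<tau> m))"
  unfolding simple_ito_integral_def
proof (intro borel_measurable_sum borel_measurable_times borel_measurable_diff)
  fix k assume "k \<in> {..<m}"
  then have k: "k < m" by simp
  then have "\<tau> k \<le> \<tau> (Suc k)" using assms by (simp add: simple_process_def)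
  note le = simple_process_partition[OF assms, of k] simple_process_partition[OF assms, of "Suc k"]
  show "\<xi> k \<in> borel_measurable (F (\<tau> m))"
    using le k assms by (intro filtration_measurable[OF M le(1,2)]) (simp_all add: simple_process_def)
  show "w (\<tau> (Suc k)) \<in> borel_measurable (F (\<tau> m))" "w (\<tau> k) \<in> borel_measurable (F (\<tau> m))"
    using le k filtration_measurable[OF M le(1,2) brownian_measurable]
      filtration_measurable[OF M le(3,4) brownian_measurable] by simp_all
qed

text \<open>The cross terms vanish because the increment over the last interval is independent of the
  integral up to its left endpoint.\<close>

lemma simple_ito_isometry:
  assumes "simple_process F t m \<tau> \<xi>"
  shows "integrable M (\<lambda>\<omega>. (simple_ito_integral w m \<tau> \<xi> \<omega>)\<^sup>2)"
    and "expectation (\<lambda>\<omega>. (simple_ito_integral w m \<tau> \<xi> \<omega>)\<^sup>2)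
      = (\<Sum>k<m. (\<tau> (Suc k) - \<tau> k) * expectation (\<lambda>\<omega>. (\<xi> k \<omega>)\<^sup>2))"
    and "expectation (simple_ito_integral w m \<tau> \<xi>) = 0"
proof -
  let ?S = "\<lambda>m. simple_ito_integral w m \<tau> \<xi>"
  have "integrable M (\<lambda>\<omega>. (?S m \<omega>)\<^sup>2) \<and> expectation (\<lambda>\<omega>. (?S m \<omega>)\<^sup>2)
      = (\<Sum>k<m. (\<tau> (Suc k) - \<tau> k) * expectation (\<lambda>\<omega>. (\<xi> k \<omega>)\<^sup>2)) \<and> expectation (?S m) = 0"
    using assms
  proof (induction m)
    case 0
    then show ?case by (simp add: simple_ito_integral_def)
  next
    case (Suc m)
    note IH = Suc.IH[OF simple_process_Suc[OF Suc.prems]]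
    have \<tau>: "0 \<le> \<tau> m" "\<tau> m \<le> \<tau> (Suc m)"
      using simple_process_partition[OF Suc.prems, of m] Suc.prems by (auto simp: simple_process_def)
    let ?d = "\<lambda>\<omega>. w (\<tau> (Suc m)) \<omega> - w (\<tau> m) \<omega>"
    have \<xi>F: "\<xi> m \<in> borel_measurable (F (\<tau> m))" using Suc.prems by (simp add: simple_process_def)
    have SF: "?S m \<in> borel_measurable (F (\<tau> m))"
      by (rule simple_ito_integral_measurable[OF simple_process_Suc[OF Suc.prems]])
    have \<xi>M [measurable]: "\<xi> m \<in> borel_measurable M" and SM [measurable]: "?S m \<in> borel_measurable M"
      using filtration_measurable_M[OF M \<tau>(1)] \<xi>F SF by auto
    have iS: "integrable M (?S m)"
      using IH square_integrable_imp_integrable[OF SM] by simp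
    have i\<xi>: "integrable M (\<xi> m)" and i\<xi>2: "integrable M (\<lambda>\<omega>. (\<xi> m \<omega>)\<^sup>2)"
      using simple_process_integrable[OF Suc.prems, of m] by simp_all
    have iS\<xi>: "integrable M (\<lambda>\<omega>. ?S m \<omega> * \<xi> m \<omega>)"
      using IH i\<xi>2 by (intro integrable_mult_of_squares) auto
    have S\<xi>F: "(\<lambda>\<omega>. ?S m \<omega> * \<xi> m \<omega>) \<in> borel_measurable (F (\<tau> m))"
      and \<xi>2F: "(\<lambda>\<omega>. (\<xi> m \<omega>)\<^sup>2) \<in> borel_measurable (F (\<tau> m))" using SF \<xi>F by simp_all
    \<comment> \<open>\<open>p1\<close> handles the mixed term of the square, \<open>p2\<close> the
      new diagonal term, and \<open>p3\<close> the mean.\<close>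
    note p1 = brownian_increment_product[OF \<tau> S\<xi>F iS\<xi>]
    note p2 = brownian_increment_product[OF \<tau> \<xi>2F i\<xi>2]
    note p3 = brownian_increment_product[OF \<tau> \<xi>F i\<xi>]
    have sq: "(?S (Suc m) \<omega>)\<^sup>2 = (?S m \<omega>)\<^sup>2 + 2 * (?S m \<omega> * \<xi> m \<omega> * ?d \<omega>) + (\<xi> m \<omega>)\<^sup>2 * (?d \<omega>)\<^sup>2" for \<omega>
      by (simp add: simple_ito_integral_def power2_eq_square algebra_simps)
    have lin: "?S (Suc m) = (\<lambda>\<omega>. ?S m \<omega> + \<xi> m \<omega> * ?d \<omega>)"
      by (simp add: simple_ito_integral_def fun_eq_iff)
    have "integrable M (\<lambda>\<omega>. (?S (Suc m) \<omega>)\<^sup>2)"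
      unfolding sq using IH p1 p2 by (intro Bochner_Integration.integrable_add) auto
    moreover have "expectation (\<lambda>\<omega>. (?S (Suc m) \<omega>)\<^sup>2) =
        (\<Sum>k<Suc m. (\<tau> (Suc k) - \<tau> k) * expectation (\<lambda>\<omega>. (\<xi> k \<omega>)\<^sup>2))"
      unfolding sq using IH p1 p2 by simp
    moreover have "expectation (?S (Suc m)) = 0"
      unfolding lin using IH p3 iS by simp
    ultimately show ?case by blast
  qed
  then show "integrable M (\<lambda>\<omega>. (?S m \<omega>)\<^sup>2)" "expectation (\<lambda>\<omega>. (?S m \<omega>)\<^sup>2)
      = (\<Sum>k<m. (\<tau> (Suc k) - \<tau> k) * expectation (\<lambda>\<omega>. (\<xi> k \<omega>)\<^sup>2))" "expectation (?S m) = 0"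
    by auto
qed

section \<open>The isometry between processes on time and probability space and random
  variables\<close>

lemma simple_process_val_power2:
  assumes "simple_process F t m \<tau> \<xi>"
  shows "(simple_process_val m \<tau> \<xi> s \<omega>)\<^sup>2 = (\<Sum>k<m. (\<xi> k \<omega>)\<^sup>2 * indicator {\<tau> k<..\<tau> (Suc k)} s)"
  using assms
proof (induction m)
  case 0
  then show ?case by (simp add: simple_process_val_def)
next
  case (Suc m)
  note sp = simple_process_Suc[OF Suc.prems]
  \<comment> \<open>The half-open intervals are disjoint, so the earlier part vanishes wherever the
    new summand can be nonzero, and squaring creates no mixed products.\<close>
  have "simple_process_val m \<tau> \<xi> s \<omega> = 0" if "\<tau> m < s"
    unfolding simple_process_val_def
  proof (rule sum.neutral, rule ballI)
    fix k assume "k \<in> {..<m}"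
    then have "\<tau> (Suc k) \<le> \<tau> m" using simple_process_partition(2)[OF sp, of "Suc k"] by simp
    then show "\<xi> k \<omega> * indicator {\<tau> k<..\<tau> (Suc k)} s = 0" using that by simp
  qed
  then have "(simple_process_val (Suc m) \<tau> \<xi> s \<omega>)\<^sup>2
      = (simple_process_val m \<tau> \<xi> s \<omega>)\<^sup>2 + (\<xi> m \<omega>)\<^sup>2 * indicator {\<tau> m<..\<tau> (Suc m)} s"
    by (cases "s \<in> {\<tau> m<..\<tau> (Suc m)}") (simp_all add: simple_process_val_def)
  then show ?case using Suc.IH[OF sp] by simp
qed

lemma simple_process_val_measurable:
  assumes sp: "simple_process F t m \<tau> \<xi>"
  shows "(\<lambda>(s, \<omega>). simple_process_val m \<tau> \<xi> s \<omega>)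
    \<in> borel_measurable (restrict_space lborel {0..t} \<Otimes>\<^sub>M M)"
  unfolding simple_process_val_def split_beta
proof (intro borel_measurable_sum borel_measurable_times)
  fix k assume "k \<in> {..<m}"
  then have [measurable]: "\<xi> k \<in> borel_measurable M" using simple_process_measurable[OF sp] by simp
  show "(\<lambda>p. \<xi> k (snd p)) \<in> borel_measurable (restrict_space lborel {0..t} \<Otimes>\<^sub>M M)" by simp
  have "(\<lambda>s. indicator {\<tau> k<..\<tau> (Suc k)} s :: real) \<in> borel_measurable (restrict_space lborel {0..t})"
    by (intro measurable_restrict_space1) simp
  then show "(\<lambda>p. indicator {\<tau> k<..\<tau> (Suc k)} (fst p) :: real)
      \<in> borel_measurable (restrict_space lborel {0..t} \<Otimes>\<^sub>M M)"
    by (rule measurable_compose[OF measurable_fst])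
qed

text \<open>Both sides are the sum of interval lengths times second moments of the values: on the
  left by Tonelli, integrating over \<open>\<omega>\<close> first, on the right by the computation
  for simple integrals. The nonnegative integrals match the distances in
  \<open>is_ito_integral\<close>.\<close>

lemma nn_integral_simple_process_val:
  assumes sp: "simple_process F t m \<tau> \<xi>"
  shows "(\<integral>\<^sup>+(s, \<omega>). ennreal ((simple_process_val m \<tau> \<xi> s \<omega>)\<^sup>2) \<partial>(restrict_space lborel {0..t} \<Otimes>\<^sub>M M))
    = (\<integral>\<^sup>+\<omega>. ennreal ((simple_ito_integral w m \<tau> \<xi> \<omega>)\<^sup>2) \<partial>M)"
proof -
  let ?N = "restrict_space lborel {0..t}"
  let ?J = "\<lambda>k. {\<tau> k<..\<tau> (Suc k)}"
  have mono: "\<tau> k \<le> \<tau> (Suc k)" if "k < m" for k using sp that by (simp add: simple_process_def)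
  note int\<xi> = simple_process_integrable(2)[OF sp]
  have piece: "(\<integral>\<^sup>+\<omega>. ennreal ((\<xi> k \<omega>)\<^sup>2 * indicator (?J k) s) \<partial>M)
      = ennreal (expectation (\<lambda>\<omega>. (\<xi> k \<omega>)\<^sup>2)) * indicator (?J k) s" if k: "k < m" for k s
    using nn_integral_eq_integral[OF int\<xi>[OF k]] by (cases "s \<in> ?J k") simp_all
  have "(\<integral>\<^sup>+(s, \<omega>). ennreal ((simple_process_val m \<tau> \<xi> s \<omega>)\<^sup>2) \<partial>(?N \<Otimes>\<^sub>M M))
      = (\<integral>\<^sup>+s. \<integral>\<^sup>+\<omega>. ennreal ((simple_process_val m \<tau> \<xi> s \<omega>)\<^sup>2) \<partial>M \<partial>?N)"
    using simple_process_val_measurable[OF sp]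
    by (subst nn_integral_fst[symmetric]) (simp_all add: split_beta)
  also have "\<dots> = (\<integral>\<^sup>+s. (\<Sum>k<m. ennreal (expectation (\<lambda>\<omega>. (\<xi> k \<omega>)\<^sup>2)) * indicator (?J k) s) \<partial>?N)"
  proof (rule nn_integral_cong)
    fix s
    have "(\<integral>\<^sup>+\<omega>. ennreal ((simple_process_val m \<tau> \<xi> s \<omega>)\<^sup>2) \<partial>M)
        = (\<integral>\<^sup>+\<omega>. (\<Sum>k<m. ennreal ((\<xi> k \<omega>)\<^sup>2 * indicator (?J k) s)) \<partial>M)"
      by (simp add: simple_process_val_power2[OF sp] sum_nonneg)
    also have "\<dots> = (\<Sum>k<m. \<integral>\<^sup>+\<omega>. ennreal ((\<xi> k \<omega>)\<^sup>2 * indicator (?J k) s) \<partial>M)"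
      using simple_process_measurable[OF sp] by (intro nn_integral_sum) auto
    finally show "(\<integral>\<^sup>+\<omega>. ennreal ((simple_process_val m \<tau> \<xi> s \<omega>)\<^sup>2) \<partial>M)
        = (\<Sum>k<m. ennreal (expectation (\<lambda>\<omega>. (\<xi> k \<omega>)\<^sup>2)) * indicator (?J k) s)"
      by (simp add: piece)
  qed
  also have "\<dots> = (\<Sum>k<m. \<integral>\<^sup>+s. ennreal (expectation (\<lambda>\<omega>. (\<xi> k \<omega>)\<^sup>2)) * indicator (?J k) s \<partial>?N)"
    by (intro nn_integral_sum borel_measurable_times_ennreal borel_measurable_const
        measurable_restrict_space1 borel_measurable_indicator) simp
  also have "\<dots> = (\<Sum>k<m. ennreal ((\<tau> (Suc k) - \<tau> k) * expectation (\<lambda>\<omega>. (\<xi> k \<omega>)\<^sup>2)))"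
  proof (rule sum.cong[OF refl])
    fix k assume "k \<in> {..<m}"
    then have k: "k < m" by simp
    \<comment> \<open>Restricting the measure to \<open>{0..t}\<close> therefore cuts off no part of
      the interval, and its measure is the full length.\<close>
    have sub: "?J k \<subseteq> {0..t}"
      using simple_process_partition[OF sp, of k] simple_process_partition[OF sp, of "Suc k"] k sp
      by (auto simp: simple_process_def)
    then have "?J k \<in> sets ?N" by (simp add: sets_restrict_space_iff)
    then have "(\<integral>\<^sup>+s. ennreal (expectation (\<lambda>\<omega>. (\<xi> k \<omega>)\<^sup>2)) * indicator (?J k) s \<partial>?N)
        = ennreal (expectation (\<lambda>\<omega>. (\<xi> k \<omega>)\<^sup>2)) * emeasure ?N (?J k)"
      by (rule nn_integral_cmult_indicator)
    also have "emeasure ?N (?J k) = ennreal (\<tau> (Suc k) - \<tau> k)"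
      using sub mono[OF k] by (simp add: emeasure_restrict_space)
    finally show "(\<integral>\<^sup>+s. ennreal (expectation (\<lambda>\<omega>. (\<xi> k \<omega>)\<^sup>2)) * indicator (?J k) s \<partial>?N)
        = ennreal ((\<tau> (Suc k) - \<tau> k) * expectation (\<lambda>\<omega>. (\<xi> k \<omega>)\<^sup>2))"
      using mono[OF k] by (simp add: ennreal_mult mult.commute)
  qed
  also have "\<dots> = ennreal (\<Sum>k<m. (\<tau> (Suc k) - \<tau> k) * expectation (\<lambda>\<omega>. (\<xi> k \<omega>)\<^sup>2))"
    using mono by (intro sum_ennreal) simp
  also have "\<dots> = (\<integral>\<^sup>+\<omega>. ennreal ((simple_ito_integral w m \<tau> \<xi> \<omega>)\<^sup>2) \<partial>M)"
    using nn_integral_eq_integral[OF simple_ito_isometry(1)[OF sp]] simple_ito_isometry(2)[OF sp]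
    by simp
  finally show ?thesis .
qed

section \<open>Passage from simple processes to general integrands\<close>

lemma nn_integral_power2_le:
  fixes f g :: "'b \<Rightarrow> real"
  assumes [measurable]: "f \<in> borel_measurable N" "g \<in> borel_measurable N"
  shows "(\<integral>\<^sup>+x. ennreal ((f x)\<^sup>2) \<partial>N)
    \<le> 2 * (\<integral>\<^sup>+x. ennreal ((f x - g x)\<^sup>2) \<partial>N) + 2 * (\<integral>\<^sup>+x. ennreal ((g x)\<^sup>2) \<partial>N)"
proof -
  \<comment> \<open>The right side minus the left side is exactly
    \<open>(f x - 2 * g x)\<^sup>2\<close>. This serves as a triangle inequality without square
    roots.\<close>
  have "(f x)\<^sup>2 \<le> 2 * (f x - g x)\<^sup>2 + 2 * (g x)\<^sup>2" for x
    using zero_le_power2[of "f x - 2 * g x"] by (simp add: power2_eq_square algebra_simps)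
  then have "ennreal ((f x)\<^sup>2) \<le> 2 * ennreal ((f x - g x)\<^sup>2) + 2 * ennreal ((g x)\<^sup>2)" for x
    by (simp add: ennreal_leI flip: ennreal_numeral ennreal_mult ennreal_plus)
  then have "(\<integral>\<^sup>+x. ennreal ((f x)\<^sup>2) \<partial>N)
      \<le> (\<integral>\<^sup>+x. 2 * ennreal ((f x - g x)\<^sup>2) + 2 * ennreal ((g x)\<^sup>2) \<partial>N)"
    by (intro nn_integral_mono)
  then show ?thesis by (simp add: nn_integral_add nn_integral_cmult)
qed

text \<open>The isometry for simple processes passes to the limit up to a constant factor, which
  avoids common refinements of partitions.\<close>

lemma ito_integral_moments:
  assumes ito: "is_ito_integral M F w t h I" and "0 \<le> t"
    and h: "\<And>s \<omega>. s \<in> {0..t} \<Longrightarrow> \<bar>h s \<omega>\<bar> \<le> B"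
  shows "integrable M (\<lambda>\<omega>. (I \<omega>)\<^sup>2)"
    and "expectation (\<lambda>\<omega>. (I \<omega>)\<^sup>2) \<le> 4 * (B\<^sup>2 * t)"
    and "expectation I = 0"
proof -
  let ?N = "restrict_space lborel {0..t} \<Otimes>\<^sub>M M"
  obtain m \<tau> \<xi> where sp: "\<And>j. simple_process F t (m j) (\<tau> j) (\<xi> j)"
    and a: "(\<lambda>j. \<integral>\<^sup>+(s, \<omega>). ennreal ((h s \<omega> - simple_process_val (m j) (\<tau> j) (\<xi> j) s \<omega>)\<^sup>2) \<partial>?N) \<longlonglongrightarrow> 0"
    and b: "(\<lambda>j. \<integral>\<^sup>+\<omega>. ennreal ((I \<omega> - simple_ito_integral w (m j) (\<tau> j) (\<xi> j) \<omega>)\<^sup>2) \<partial>M) \<longlonglongrightarrow> 0"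
    using ito unfolding is_ito_integral_def by blast
  have hM: "(\<lambda>(s, \<omega>). h s \<omega>) \<in> borel_measurable ?N" and IM [measurable]: "I \<in> borel_measurable M"
    using ito unfolding is_ito_integral_def by blast+
  define S where "S j = simple_ito_integral w (m j) (\<tau> j) (\<xi> j)" for j
  define V where "V j = (\<lambda>(s, \<omega>). simple_process_val (m j) (\<tau> j) (\<xi> j) s \<omega>)" for j
  define H where "H = (\<lambda>(s, \<omega>). h s \<omega>)"
  have [measurable]: "H \<in> borel_measurable ?N" "V j \<in> borel_measurable ?N" for j
    using hM simple_process_val_measurable[OF sp] by (simp_all add: H_def V_def)
  have [measurable]: "S j \<in> borel_measurable M" for j
    unfolding S_def using simple_process_partition(1)[OF sp, of "m j" j]
    by (intro filtration_measurable_M[OF M _ simple_ito_integral_measurable[OF sp]]) simp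
  \<comment> \<open>The difference is reversed so that it has the shape needed to estimate
    \<open>V j\<close> by \<open>H\<close>.\<close>
  have a': "(\<lambda>j. \<integral>\<^sup>+p. ennreal ((V j p - H p)\<^sup>2) \<partial>?N) \<longlonglongrightarrow> 0"
    using a by (simp add: H_def V_def case_prod_unfold power2_commute)
  have b': "(\<lambda>j. \<integral>\<^sup>+\<omega>. ennreal ((I \<omega> - S j \<omega>)\<^sup>2) \<partial>M) \<longlonglongrightarrow> 0"
    using b by (simp add: S_def)
  have iso: "(\<integral>\<^sup>+p. ennreal ((V j p)\<^sup>2) \<partial>?N) = (\<integral>\<^sup>+\<omega>. ennreal ((S j \<omega>)\<^sup>2) \<partial>M)" for j
    using nn_integral_simple_process_val[OF sp, of j] by (simp add: S_def V_def case_prod_unfold)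
  have "(\<integral>\<^sup>+p. ennreal ((H p)\<^sup>2) \<partial>?N) \<le> (\<integral>\<^sup>+p. ennreal (B\<^sup>2) \<partial>?N)"
  proof (rule nn_integral_mono)
    fix p assume "p \<in> space ?N"
    then have "\<bar>H p\<bar> \<le> B"
      using h by (auto simp: H_def split_beta space_pair_measure space_restrict_space)
    then show "ennreal ((H p)\<^sup>2) \<le> ennreal (B\<^sup>2)"
      using power_mono[of "\<bar>H p\<bar>" B 2] by (simp add: ennreal_leI)
  qed
  also have "\<dots> = (\<integral>\<^sup>+s. \<integral>\<^sup>+\<omega>. ennreal (B\<^sup>2) \<partial>M \<partial>restrict_space lborel {0..t})"
    by (subst nn_integral_fst[symmetric]) simp_all
  also have "\<dots> = ennreal (B\<^sup>2 * t)"
    using \<open>0 \<le> t\<close> by (simp add: emeasure_space_1 emeasure_restrict_space space_restrict_space ennreal_mult)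
  finally have K: "(\<integral>\<^sup>+p. ennreal ((H p)\<^sup>2) \<partial>?N) \<le> ennreal (B\<^sup>2 * t)" .
  \<comment> \<open>The factor 2 is paid twice, once from \<open>I\<close> to \<open>S j\<close> and
    once from \<open>V j\<close> to \<open>H\<close>, with the exact isometry in between; this is
    the origin of the final constant 4.\<close>
  have bound: "(\<integral>\<^sup>+\<omega>. ennreal ((I \<omega>)\<^sup>2) \<partial>M) \<le> 2 * (\<integral>\<^sup>+\<omega>. ennreal ((I \<omega> - S j \<omega>)\<^sup>2) \<partial>M)
      + 2 * (2 * (\<integral>\<^sup>+p. ennreal ((V j p - H p)\<^sup>2) \<partial>?N) + 2 * ennreal (B\<^sup>2 * t))" for j
  proof -
    have "(\<integral>\<^sup>+\<omega>. ennreal ((I \<omega>)\<^sup>2) \<partial>M) \<le> 2 * (\<integral>\<^sup>+\<omega>. ennreal ((I \<omega> - S j \<omega>)\<^sup>2) \<partial>M)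
        + 2 * (\<integral>\<^sup>+p. ennreal ((V j p)\<^sup>2) \<partial>?N)"
      unfolding iso by (rule nn_integral_power2_le) simp_all
    also have "(\<integral>\<^sup>+p. ennreal ((V j p)\<^sup>2) \<partial>?N) \<le> 2 * (\<integral>\<^sup>+p. ennreal ((V j p - H p)\<^sup>2) \<partial>?N)
        + 2 * (\<integral>\<^sup>+p. ennreal ((H p)\<^sup>2) \<partial>?N)"
      by (rule nn_integral_power2_le) simp_all
    also note K
    finally show ?thesis by (simp add: add_left_mono mult_left_mono)
  qed
  have "(\<lambda>j. 2 * (\<integral>\<^sup>+\<omega>. ennreal ((I \<omega> - S j \<omega>)\<^sup>2) \<partial>M)
      + 2 * (2 * (\<integral>\<^sup>+p. ennreal ((V j p - H p)\<^sup>2) \<partial>?N) + 2 * ennreal (B\<^sup>2 * t)))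
      \<longlonglongrightarrow> 2 * 0 + 2 * (2 * 0 + 2 * ennreal (B\<^sup>2 * t))"
    by (intro tendsto_add ennreal_tendsto_cmult a' b' tendsto_const) simp_all
  then have "(\<integral>\<^sup>+\<omega>. ennreal ((I \<omega>)\<^sup>2) \<partial>M) \<le> 2 * 0 + 2 * (2 * 0 + 2 * ennreal (B\<^sup>2 * t))"
    by (rule LIMSEQ_le_const) (use bound in blast)
  also have "\<dots> = ennreal (4 * (B\<^sup>2 * t))"
    using \<open>0 \<le> t\<close> by (simp add: mult.assoc[symmetric] ennreal_mult)
  finally have I2: "(\<integral>\<^sup>+\<omega>. ennreal ((I \<omega>)\<^sup>2) \<partial>M) \<le> ennreal (4 * (B\<^sup>2 * t))" .
  show intI: "integrable M (\<lambda>\<omega>. (I \<omega>)\<^sup>2)"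
    using I2 by (intro integrableI_nonneg) (auto intro: le_less_trans)
  show "expectation (\<lambda>\<omega>. (I \<omega>)\<^sup>2) \<le> 4 * (B\<^sup>2 * t)"
    using I2 \<open>0 \<le> t\<close> by (simp add: nn_integral_eq_integral[OF intI])
  \<comment> \<open>Since \<open>S j\<close> has mean zero, \<open>I\<close> and
    \<open>I - S j\<close> have the same mean, and Cauchy-Schwarz against the constant 1 bounds its
    square by a quantity that tends to 0.\<close>
  have "ennreal ((expectation I)\<^sup>2) \<le> (\<integral>\<^sup>+\<omega>. ennreal ((I \<omega> - S j \<omega>)\<^sup>2) \<partial>M)" for j
  proof -
    have S2: "integrable M (\<lambda>\<omega>. (S j \<omega>)\<^sup>2)" and ES: "expectation (S j) = 0"
      using simple_ito_isometry[OF sp, of j] by (simp_all add: S_def)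
    have d: "integrable M (\<lambda>\<omega>. (I \<omega> - S j \<omega>)\<^sup>2)"
      using intI S2 integrable_mult_of_squares[OF _ _ intI S2]
      by (simp add: power2_diff mult.assoc)
    have "expectation I = expectation (\<lambda>\<omega>. I \<omega> - S j \<omega>)"
      using square_integrable_imp_integrable[OF _ intI] square_integrable_imp_integrable[OF _ S2] ES
      by simp
    then have "(expectation I)\<^sup>2 \<le> expectation (\<lambda>\<omega>. (I \<omega> - S j \<omega>)\<^sup>2)"
      using Cauchy_Schwarz_integral[of "\<lambda>\<omega>. I \<omega> - S j \<omega>" M "\<lambda>_. 1"] d by (simp add: prob_space)
    then show ?thesis by (simp add: nn_integral_eq_integral[OF d] ennreal_leI)
  qed
  then have "ennreal ((expectation I)\<^sup>2) \<le> 0"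
    by (intro LIMSEQ_le_const[OF b']) blast
  then show "expectation I = 0" by simp
qed

end

section \<open>The mean of a mild solution\<close>

text \<open>On \<open>{0..T}\<close> the kernel lies between \<open>exp (- l * T)\<close> and 1. The
  lower bound makes \<open>J\<close> positive, so that a source coefficient can be divided out; the
  upper bound does not depend on \<open>l\<close> and hence serves all eigenvalues at once.\<close>

lemma heat_kernel_integral:
  fixes l T C c :: real
  assumes T: "0 < T" and l: "0 \<le> l" and R: "R \<in> borel_measurable (lebesgue_on {0..T})"
    and C: "AE t in lebesgue_on {0..T}. \<bar>R t\<bar> \<le> C"
    and c: "0 < c" "AE t in lebesgue_on {0..T}. c \<le> R t"
  defines "J \<equiv> LINT s:{0..T}|lebesgue. exp (- l * (T - s)) * R s"
  shows "0 < J" and "J \<le> C * T"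
proof -
  let ?N = "lebesgue_on {0..T}"
  let ?f = "\<lambda>s. exp (- l * (T - s)) * R s"
  have J: "J = (\<integral>s. ?f s \<partial>?N)"
    by (simp add: J_def set_lebesgue_integral_def integral_restrict_space)
  interpret N: finite_measure ?N by (rule finite_measure_lebesgue_on) simp
  have meas: "measure ?N (space ?N) = T"
    using T by (simp add: measure_restrict_space space_restrict_space)
  have "(\<lambda>s. exp (- l * (T - s))) \<in> borel_measurable ?N"
    by (intro continuous_imp_measurable_on_sets_lebesgue continuous_intros) simp
  then have fM: "?f \<in> borel_measurable ?N" using R by simp
  have AE: "AE s in ?N. c * exp (- l * T) \<le> ?f s \<and> ?f s \<le> C"
    using C c(2) AE_space
  proof eventually_elim
    case (elim s)
    then have s: "0 \<le> s" "s \<le> T" by (simp_all add: space_restrict_space)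
    have "exp (- l * T) \<le> exp (- l * (T - s))" using s l by (simp add: algebra_simps)
    moreover have "exp (- l * (T - s)) \<le> 1" using s l by simp
    ultimately have "exp (- l * T) * c \<le> exp (- l * (T - s)) * R s"
      and "exp (- l * (T - s)) * R s \<le> 1 * C"
      using elim c(1) by (intro mult_mono; simp)+
    then show ?case by (simp add: mult.commute)
  qed
  have int: "integrable ?N ?f"
  proof (rule N.integrable_const_bound[OF _ fM])
    show "AE s in ?N. norm (?f s) \<le> C"
      using AE
    proof eventually_elim
      case (elim s)
      moreover have "0 < c * exp (- l * T)" using c(1) by simp
      ultimately show ?case unfolding real_norm_def by linarith
    qed
  qed
  have "T * (c * exp (- l * T)) = (\<integral>s. c * exp (- l * T) \<partial>?N)" using meas by simp
  also have "\<dots> \<le> J"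
    unfolding J using AE by (intro integral_mono_AE int N.integrable_const) (auto elim: eventually_mono)
  finally show "0 < J" using T c(1) by (smt (verit) exp_gt_zero mult_pos_pos)
  have "J \<le> (\<integral>s. C \<partial>?N)"
    unfolding J using AE by (intro integral_mono_AE int N.integrable_const) (auto elim: eventually_mono)
  then show "J \<le> C * T" using meas by (simp add: mult.commute)
qed

lemma summable_orthonormal_basis_coeff:
  assumes "orthonormal_basis_L2 D \<phi>" "L2 D v"
  shows "summable (\<lambda>n. (L2_inner D v (\<phi> n))\<^sup>2)"
  using Parseval[of D \<phi> "\<lambda>n. L2_inner D v (\<phi> n)" v] assms
  by (auto simp: orthonormal_basis_L2_def sums_iff)

text \<open>Equal coefficients mean that both functions are limits of one and the same sequence of
  partial sums.\<close>

lemma orthonormal_basis_eq: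
  assumes \<phi>: "orthonormal_basis_L2 D \<phi>" and L: "L2 D u" "L2 D v"
    and eq: "\<And>n. L2_inner D u (\<phi> n) = L2_inner D v (\<phi> n)"
  shows "AE x in lebesgue_on D. u x = v x"
proof (rule L2_tendsto_unique)
  show "L2_tendsto D (\<lambda>N x. \<Sum>n<N. L2_inner D v (\<phi> n) * \<phi> n x) u"
    using \<phi> L(1) unfolding orthonormal_basis_L2_def eq[symmetric] by blast
  show "L2_tendsto D (\<lambda>N x. \<Sum>n<N. L2_inner D v (\<phi> n) * \<phi> n x) v"
    using \<phi> L(2) unfolding orthonormal_basis_L2_def by blast
qed

text \<open>Square integrability of the solution on \<open>D \<times> \<Omega>\<close> matters twice: it justifies exchanging the
  expectation with the \<open>L\<^sup>2(D)\<close> pairing, and it excludes that the expectation is the junk value 0 of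
  a non-integrable variable.\<close>

lemma mild_solution_mean_coeff:
  fixes D :: "(real ^ 'd) set" and \<phi> :: "nat \<Rightarrow> real ^ 'd \<Rightarrow> real" and M :: "'w measure"
  assumes D: "open D" "bounded D" and \<phi>: "orthonormal_basis_L2 D \<phi>"
    and M: "complete_filtered_prob_space M F" and w: "brownian_motion M F w"
    and L: "L2 D u0" "L2 D g" "L2 D f"
    and T: "0 < T" and lam: "\<And>n. 0 \<le> lam n" and R: "R \<in> borel_measurable (lebesgue_on {0..T})"
    and C: "AE t in lebesgue_on {0..T}. \<bar>R t\<bar> \<le> C"
    and c: "0 < c" "AE t in lebesgue_on {0..T}. c \<le> R t"
    and u: "mild_solution D T lam \<phi> M F w u0 R f g u"
  shows "L2_inner D (\<lambda>x. prob_space.expectation M (u x T)) (\<phi> n)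
    = mild_coeff R T (lam n) (L2_inner D u0 (\<phi> n)) (L2_inner D f (\<phi> n)) 0"
proof -
  interpret prob_space M using M by (simp add: complete_filtered_prob_space_def)
  have "finite_measure (lebesgue_on D)"
    by (rule finite_measure_lebesgue_on) (rule lmeasurable_open[OF D(2,1)])
  then interpret DM: pair_sigma_finite "lebesgue_on D" M
    by (simp add: pair_sigma_finite_def finite_measure.sigma_finite_measure finite_measure_def
        sigma_finite_measure_axioms)
  let ?P = "lebesgue_on D \<Otimes>\<^sub>M M"
  have \<phi>L: "\<And>n. L2 D (\<phi> n)" and on: "\<And>m n. L2_inner D (\<phi> m) (\<phi> n) = (if m = n then 1 else 0)"
    using \<phi> unfolding orthonormal_basis_L2_def by blast+
  have TT: "T \<in> {0..T}" using T by simp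
  \<comment> \<open>The stochastic integral is an additive term of \<open>mild_coeff\<close>;
    setting it to 0 isolates the deterministic part, so the coefficients of the solution are
    \<open>d n + I n \<omega>\<close>.\<close>
  define d where "d n = mild_coeff R T (lam n) (L2_inner D u0 (\<phi> n)) (L2_inner D f (\<phi> n)) 0" for n
  define U where "U = (\<lambda>(x, \<omega>). u x T \<omega>)"
  have UM [measurable]: "U \<in> borel_measurable ?P"
    using u TT unfolding mild_solution_def U_def by blast
  obtain I' where I': "\<forall>n. \<forall>t\<in>{0..T}. is_ito_integral M F w t
        (\<lambda>s \<omega>. exp (- lam n * (t - s)) * L2_inner D g (\<phi> n)) (I' n t)"
    "\<forall>t\<in>{0..T}. AE \<omega> in M. L2_tendsto D (\<lambda>N x. \<Sum>n<N. mild_coeff R t (lam n)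
        (L2_inner D u0 (\<phi> n)) (L2_inner D f (\<phi> n)) (I' n t \<omega>) * \<phi> n x) (\<lambda>x. u x t \<omega>)"
    using u unfolding mild_solution_def by blast
  define I where "I n = I' n T" for n
  have ito: "\<And>n. is_ito_integral M F w T
      (\<lambda>s \<omega>. exp (- lam n * (T - s)) * L2_inner D g (\<phi> n)) (I n)"
    and exp_I: "AE \<omega> in M. L2_tendsto D (\<lambda>N x. \<Sum>n<N. mild_coeff R T (lam n)
      (L2_inner D u0 (\<phi> n)) (L2_inner D f (\<phi> n)) (I n \<omega>) * \<phi> n x) (\<lambda>x. u x T \<omega>)"
    using I' TT unfolding I_def by blast+
  have "AE \<omega> in M. L2_tendsto D (\<lambda>N x. \<Sum>n<N. (d n + I n \<omega>) * \<phi> n x) (\<lambda>x. u x T \<omega>)"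
    using exp_I by (simp add: d_def mild_coeff_def)
  \<comment> \<open>Both facts are read off path by path from the expansion. The exceptional null
    set is that of the expansion and hence common to all \<open>n\<close>; Parseval is phrased in
    \<open>ennreal\<close> so that it can be integrated over \<open>\<omega>\<close> before
    finiteness is known.\<close>
  then have sol: "AE \<omega> in M. (\<integral>\<^sup>+x. ennreal ((U (x, \<omega>))\<^sup>2) \<partial>lebesgue_on D)
        = (\<Sum>n. ennreal ((d n + I n \<omega>)\<^sup>2))
      \<and> (\<forall>n. (\<integral>x. U (x, \<omega>) * \<phi> n x \<partial>lebesgue_on D) = d n + I n \<omega>)"
  proof eventually_elim
    case (elim \<omega>)
    then have "L2 D (\<lambda>x. u x T \<omega>)" by (simp add: L2_tendsto_def)
    then have "(\<integral>\<^sup>+x. ennreal ((u x T \<omega>)\<^sup>2) \<partial>lebesgue_on D) = ennreal (\<integral>x. (u x T \<omega>)\<^sup>2 \<partial>lebesgue_on D)"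
      by (simp add: nn_integral_eq_integral L2_integrable_power2)
    also have "\<dots> = (\<Sum>n. ennreal ((d n + I n \<omega>)\<^sup>2))"
      by (rule suminf_ennreal_eq[symmetric]) (use Parseval[OF \<phi>L on elim] in simp_all)
    finally show ?case
      using orthonormal_expansion_coeff[OF \<phi>L on elim] by (simp add: U_def L2_inner_def)
  qed
  have hb: "\<bar>exp (- lam n * (T - s)) * L2_inner D g (\<phi> n)\<bar> \<le> \<bar>L2_inner D g (\<phi> n)\<bar>" if "s \<in> {0..T}" for n s
  proof -
    have "exp (- lam n * (T - s)) \<le> 1" using that lam[of n] by simp
    then show ?thesis by (simp add: abs_mult mult_left_le_one_le)
  qed
  note I = ito_integral_moments[OF M w ito less_imp_le[OF T] hb]
  have IM [measurable]: "I n \<in> borel_measurable M" for n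
    using ito[of n] by (simp add: is_ito_integral_def)
  have I1: "integrable M (I n)" for n
    using square_integrable_imp_integrable[OF IM I(1)] by simp
  \<comment> \<open>The factors 2 come from splitting the square of \<open>d n\<close> into initial
    value and source, \<open>C * T\<close> bounds the kernel integral, and the last term is the
    moment bound for \<open>I n\<close> with the integrand bounded by the modulus of the noise
    coefficient.\<close>
  define b where "b n = 2 * (L2_inner D u0 (\<phi> n))\<^sup>2 + 2 * ((C * T)\<^sup>2 * (L2_inner D f (\<phi> n))\<^sup>2)
      + 4 * ((L2_inner D g (\<phi> n))\<^sup>2 * T)" for n
  have bnn: "0 \<le> b n" for n using T by (simp add: b_def)
  have bsum: "summable b"
    unfolding b_def using summable_orthonormal_basis_coeff[OF \<phi>] L
    by (intro summable_add summable_mult summable_mult2) auto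
  have second: "(\<integral>\<^sup>+\<omega>. ennreal ((d n + I n \<omega>)\<^sup>2) \<partial>M) \<le> ennreal (b n)" for n
  proof -
    let ?J = "LINT s:{0..T}|lebesgue. exp (- lam n * (T - s)) * R s"
    note J = heat_kernel_integral[OF T lam R C c, of n]
    have "d n = exp (- lam n * T) * L2_inner D u0 (\<phi> n) + ?J * L2_inner D f (\<phi> n)"
      by (simp add: d_def mild_coeff_def)
    then have "(d n)\<^sup>2 \<le> 2 * (exp (- lam n * T) * L2_inner D u0 (\<phi> n))\<^sup>2 + 2 * (?J * L2_inner D f (\<phi> n))\<^sup>2"
      using sum_squares_bound[of "exp (- lam n * T) * L2_inner D u0 (\<phi> n)" "?J * L2_inner D f (\<phi> n)"]
      by (simp add: power2_sum)
    also have "(exp (- lam n * T) * L2_inner D u0 (\<phi> n))\<^sup>2 \<le> (L2_inner D u0 (\<phi> n))\<^sup>2"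
      using lam[of n] T by (simp add: power_mult_distrib mult_left_le_one_le power_le_one)
    also have "(?J * L2_inner D f (\<phi> n))\<^sup>2 \<le> (C * T)\<^sup>2 * (L2_inner D f (\<phi> n))\<^sup>2"
      unfolding power_mult_distrib[of ?J] using less_imp_le[OF J(1)] J(2)
      by (intro mult_right_mono power_mono zero_le_power2)
    finally have d2: "(d n)\<^sup>2 \<le> 2 * (L2_inner D u0 (\<phi> n))\<^sup>2 + 2 * ((C * T)\<^sup>2 * (L2_inner D f (\<phi> n))\<^sup>2)"
      by simp
    have sq: "(d n + I n \<omega>)\<^sup>2 = (d n)\<^sup>2 + 2 * d n * I n \<omega> + (I n \<omega>)\<^sup>2" for \<omega>
      by (simp add: power2_sum)
    have int: "integrable M (\<lambda>\<omega>. (d n + I n \<omega>)\<^sup>2)"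
      unfolding sq using I1[of n] I(1)[of n] by simp
    \<comment> \<open>The mixed term drops out because \<open>I n\<close> has mean zero and
      \<open>d n\<close> is deterministic.\<close>
    have "expectation (\<lambda>\<omega>. (d n + I n \<omega>)\<^sup>2) = (d n)\<^sup>2 + expectation (\<lambda>\<omega>. (I n \<omega>)\<^sup>2)"
      unfolding sq using I1[of n] I(1)[of n] I(3)[of n] by (simp add: prob_space)
    also have "\<dots> \<le> b n" using d2 I(2)[of n] by (simp add: b_def)
    finally show ?thesis by (simp add: nn_integral_eq_integral[OF int] ennreal_leI)
  qed
  have "(\<integral>\<^sup>+p. ennreal ((U p)\<^sup>2) \<partial>?P) = (\<integral>\<^sup>+\<omega>. \<integral>\<^sup>+x. ennreal ((U (x, \<omega>))\<^sup>2) \<partial>lebesgue_on D \<partial>M)"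
    by (rule DM.nn_integral_snd[symmetric]) simp
  also have "\<dots> = (\<integral>\<^sup>+\<omega>. (\<Sum>n. ennreal ((d n + I n \<omega>)\<^sup>2)) \<partial>M)"
    using sol by (intro nn_integral_cong_AE) (auto elim: eventually_mono)
  also have "\<dots> = (\<Sum>n. \<integral>\<^sup>+\<omega>. ennreal ((d n + I n \<omega>)\<^sup>2) \<partial>M)"
    by (rule nn_integral_suminf) simp
  also have "\<dots> \<le> (\<Sum>n. ennreal (b n))"
    by (intro suminf_le second) auto
  also have "\<dots> < \<infinity>" by (simp add: suminf_ennreal2[OF bnn bsum])
  finally have U2: "integrable ?P (\<lambda>p. (U p)\<^sup>2)"
    by (intro integrableI_nonneg) simp_all
  have \<phi>M [measurable]: "\<phi> n \<in> borel_measurable (lebesgue_on D)" by (rule L2_measurable[OF \<phi>L])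
  \<comment> \<open>As \<open>M\<close> has total mass 1, the eigenfunction stays square integrable
    on the product; its product with \<open>U\<close> is then integrable, which is what Fubini asks
    for.\<close>
  have "(\<integral>\<^sup>+p. ennreal ((\<phi> n (fst p))\<^sup>2) \<partial>?P) = (\<integral>\<^sup>+x. \<integral>\<^sup>+\<omega>. ennreal ((\<phi> n x)\<^sup>2) \<partial>M \<partial>lebesgue_on D)"
    by (subst nn_integral_fst[symmetric]) simp_all
  also have "\<dots> = ennreal (\<integral>x. (\<phi> n x)\<^sup>2 \<partial>lebesgue_on D)"
    by (simp add: emeasure_space_1 nn_integral_eq_integral L2_integrable_power2[OF \<phi>L])
  finally have "integrable ?P (\<lambda>p. (\<phi> n (fst p))\<^sup>2)"
    by (intro integrableI_nonneg) simp_all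
  then have "integrable ?P (\<lambda>p. U p * \<phi> n (fst p))"
    using U2 by (intro integrable_mult_of_squares) simp_all
  then have U\<phi>: "integrable ?P (\<lambda>(x, \<omega>). U (x, \<omega>) * \<phi> n x)"
    by (simp add: case_prod_unfold)
  have "L2_inner D (\<lambda>x. expectation (u x T)) (\<phi> n)
      = (\<integral>x. expectation (\<lambda>\<omega>. U (x, \<omega>) * \<phi> n x) \<partial>lebesgue_on D)"
    by (simp add: L2_inner_def U_def)
  also have "\<dots> = expectation (\<lambda>\<omega>. \<integral>x. U (x, \<omega>) * \<phi> n x \<partial>lebesgue_on D)"
    by (rule DM.Fubini_integral[OF U\<phi>, symmetric])
  also have "\<dots> = expectation (\<lambda>\<omega>. d n + I n \<omega>)"
    using sol DM.integrable_snd[OF U\<phi>]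
    by (intro integral_cong_AE borel_measurable_integrable) (auto elim: eventually_mono simp: I1)
  also have "\<dots> = d n" using I1 I(3) by (simp add: prob_space)
  finally show ?thesis by (simp add: d_def)
qed

section \<open>Recovering the source from the mean\<close>

theorem theorem3p1:
  fixes D :: "(real ^ 'd) set" and T c\<^sub>R :: real
    and a :: "'d \<Rightarrow> 'd \<Rightarrow> real ^ 'd \<Rightarrow> real" and c :: "real ^ 'd \<Rightarrow> real"
    and lam :: "nat \<Rightarrow> real" and \<phi> :: "nat \<Rightarrow> real ^ 'd \<Rightarrow> real"
    and M :: "'w measure" and F :: "real \<Rightarrow> 'w measure" and w :: "real \<Rightarrow> 'w \<Rightarrow> real"
    and u\<^sub>0 g f\<^sub>1 f\<^sub>2 :: "real ^ 'd \<Rightarrow> real" and R :: "real \<Rightarrow> real"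
    and u\<^sub>1 u\<^sub>2 :: "real ^ 'd \<Rightarrow> real \<Rightarrow> 'w \<Rightarrow> real"
  assumes "0 < T"
    and "CARD('d) \<in> {1, 2, 3}"
    and "bounded_lipschitz_domain D"
    and "elliptic_coeffs D a c"
    and "eigensystem D a c lam \<phi>"
    and "complete_filtered_prob_space M F"
    and "brownian_motion M F w"
    and "L2 D u\<^sub>0" and "L2 D g" and "L2 D f\<^sub>1" and "L2 D f\<^sub>2"
    and "R \<in> borel_measurable (lebesgue_on {0..T})"
    and "\<exists>C. AE t in lebesgue_on {0..T}. \<bar>R t\<bar> \<le> C"
    and "0 < c\<^sub>R"
    and "AE t in lebesgue_on {0..T}. c\<^sub>R \<le> R t"
    and "mild_solution D T lam \<phi> M F w u\<^sub>0 R f\<^sub>1 g u\<^sub>1"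
    and "mild_solution D T lam \<phi> M F w u\<^sub>0 R f\<^sub>2 g u\<^sub>2"
    and "\<forall>x\<in>D. prob_space.expectation M (u\<^sub>1 x T) = prob_space.expectation M (u\<^sub>2 x T)"
  shows "AE x in lebesgue_on D. f\<^sub>1 x = f\<^sub>2 x"
proof -
  have D: "open D" "bounded D"
    using assms(3) by (simp_all add: bounded_lipschitz_domain_def)
  have \<phi>: "orthonormal_basis_L2 D \<phi>" and "0 < lam 0" "incseq lam"
    using assms(5) by (simp_all add: eigensystem_def)
  then have lam: "0 \<le> lam n" for n
    using incseqD[of lam 0 n] by simp
  obtain C where C: "AE t in lebesgue_on {0..T}. \<bar>R t\<bar> \<le> C" using assms(13) by blast
  \<comment> \<open>The premise on the source is left open so that the same formula serves both
    solutions.\<close>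
  note mean = mild_solution_mean_coeff[OF D \<phi> assms(6,7,8,9) _ assms(1) lam assms(12) C assms(14,15)]
  have "L2_inner D f\<^sub>1 (\<phi> n) = L2_inner D f\<^sub>2 (\<phi> n)" for n
  proof -
    let ?J = "LINT s:{0..T}|lebesgue. exp (- lam n * (T - s)) * R s"
    have "L2_inner D (\<lambda>x. prob_space.expectation M (u\<^sub>1 x T)) (\<phi> n)
        = L2_inner D (\<lambda>x. prob_space.expectation M (u\<^sub>2 x T)) (\<phi> n)"
      unfolding L2_inner_def using assms(18)
      by (intro Bochner_Integration.integral_cong refl) (simp add: space_restrict_space)
    \<comment> \<open>The contributions of the common initial value cancel, and the source
      coefficient, being constant in time, leaves the integral.\<close>
    then have "?J * L2_inner D f\<^sub>1 (\<phi> n) = ?J * L2_inner D f\<^sub>2 (\<phi> n)"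
      unfolding mean[OF assms(10,16)] mean[OF assms(11,17)] by (simp add: mild_coeff_def)
    then show ?thesis
      using heat_kernel_integral(1)[OF assms(1) lam assms(12) C assms(14,15), of n] by simp
  qed
  then show ?thesis by (rule orthonormal_basis_eq[OF \<phi> assms(10,11)])
qed

end
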